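(* Let $\mathcal{H}$ be a real Hilbert space, $J\in\mathcal{C}$, and let $u\in\mathcal{H}$ be an eigenvector of $\partial J$ with eigenvalue $\lambda\in\mathbb{R}$. Then it holds: 1. $-u$ is an eigenvector of $\partial J$ with eigenvalue $\lambda$; 2. $\lambda\ge 0$, and $\lambda=0$ if and only if $u=0$; 3. $\lambda u=\arg\min\{\|p\| : p\in\partial J(u)\}$.
   Context: The Hilbert space $\mathcal{H}$ has inner product $\langle\cdot,\cdot\rangle$ and induced norm $\|\cdot\|$. The class $\mathcal{C}$ consists of all maps $J:\mathcal{H}\to\mathbb{R}\cup\{+\infty\}$ that are convex, lower semicontinuous with respect to the strong topology of $\mathcal{H}$, and absolutely one-homogeneous, i.e. $J(cu)=|c|J(u)$ for all $u\in\mathcal{H}$, $c\in\mathbb{R}\setminus\{0\}$, and $J(0)=0$. The subdifferential is $\partial J(u)=\{p\in\mathcal{H}:\langle p,v\rangle\le J(v)\ \forall v\in\mathcal{H},\ \langle p,u\rangle=J(u)\}$. A vector $u\in\mathcal{H}$ is an eigenvector of $\partial J$ with eigenvalue $\lambda\in\mathbb{R}$ if $\lambda u\in\partial J(u)$.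
   Formalization: Item 2 fails as printed (J=0: u=1, λ=0; or u=0, λ=-1). Proved instead: if u≠0 then λ≥0, and λ=0 iff J(u)=0; if J vanishes only at 0, then 0 is an eigenvalue of u iff u=0. *)

theory Defs
  imports "HOL-Analysis.Analysis"
begin

text \<open>
  A real Hilbert space is a type of sort \<open>{real_inner, complete_space}\<close>. Functionals with values in
  \<open>\<real> \<union> {+\<infinity>}\<close> are functions into \<^typ>\<open>ereal\<close> that avoid \<open>-\<infinity>\<close>.
\<close>

definition convex_functional :: "('a::real_vector \<Rightarrow> ereal) \<Rightarrow> bool" where
  "convex_functional J \<longleftrightarrow>
     (\<forall>u v. \<forall>t::real. 0 < t \<and> t < 1 \<longrightarrow>
        J ((1 - t) *\<^sub>R u + t *\<^sub>R v) \<le> ereal (1 - t) * J u + ereal t * J v)"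

text \<open>The topology of the type \<open>'a\<close> is the one induced by the norm, i.e. the strong topology.\<close>

definition lower_semicontinuous :: "('a::topological_space \<Rightarrow> ereal) \<Rightarrow> bool" where
  "lower_semicontinuous J \<longleftrightarrow> (\<forall>u. J u \<le> Liminf (at u) J)"

definition absolutely_one_homogeneous :: "('a::real_vector \<Rightarrow> ereal) \<Rightarrow> bool" where
  "absolutely_one_homogeneous J \<longleftrightarrow>
     J 0 = 0 \<and> (\<forall>u. \<forall>c::real. c \<noteq> 0 \<longrightarrow> J (c *\<^sub>R u) = ereal \<bar>c\<bar> * J u)"

definition class_C :: "('a::{real_inner, complete_space} \<Rightarrow> ereal) set" where
  "class_C = {J. (\<forall>u. J u \<noteq> -\<infinity>) \<and> convex_functional J \<and> lower_semicontinuous J \<and>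
                 absolutely_one_homogeneous J}"

definition subdifferential ::
  "('a::{real_inner, complete_space} \<Rightarrow> ereal) \<Rightarrow> 'a \<Rightarrow> 'a set" where
  "subdifferential J u = {p. (\<forall>v. ereal (p \<bullet> v) \<le> J v) \<and> ereal (p \<bullet> u) = J u}"

text \<open>
  The zero vector is not excluded: \<open>is_eigenvector J 0 lam\<close> holds for every real \<open>lam\<close> as soon as
  \<open>0 \<in> subdifferential J 0\<close>.
\<close>

definition is_eigenvector ::
  "('a::{real_inner, complete_space} \<Rightarrow> ereal) \<Rightarrow> 'a \<Rightarrow> real \<Rightarrow> bool" where
  "is_eigenvector J u lam \<longleftrightarrow> lam *\<^sub>R u \<in> subdifferential J u"

end

theory Submission
  imports Defs
begin

text \<open>
  Two elementary observations carry the result.  Absolute homogeneity makes \<open>J\<close> even, so a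
  subgradient \<open>p\<close> bounds \<open>J\<close> from below by \<open>v \<mapsto> \<bar>p \<bullet> v\<bar>\<close>.  Hence the subdifferential is an odd
  set-valued map, which gives the claim on \<open>- u\<close>, and \<open>J \<ge> 0\<close> as soon as any
  subgradient exists.  The sign of the eigenvalue, and the case in which it vanishes, are then read
  off from \<open>J u = lam * (norm u)\<^sup>2\<close>.

  For the minimality, every \<open>p\<close> in the subdifferential at \<open>u\<close> has the same inner product \<open>J u\<close> with
  \<open>u\<close>.  The subdifferential therefore lies in an affine hyperplane orthogonal to \<open>u\<close>, and its
  point \<open>lam u\<close>, being a multiple of the normal direction, is the foot of the perpendicular from the origin.
  By Pythagoras all other subgradients are strictly longer
  (\<open>norm_subgradient_pythagoras\<close>).  For \<open>u = 0\<close> the hyperplane degenerates to the whole space, but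
  \<open>lam u = 0\<close>, and the Pythagorean identity holds trivially.
\<close>

lemma class_C_even:
  assumes "J \<in> class_C"
  shows "J (- v) = J v"
proof -
  have "\<forall>w. \<forall>c::real. c \<noteq> 0 \<longrightarrow> J (c *\<^sub>R w) = ereal \<bar>c\<bar> * J w"
    using assms by (simp add: class_C_def absolutely_one_homogeneous_def)
  from this[rule_format, of "-1" v] show ?thesis
    by (simp add: one_ereal_def[symmetric])
qed

lemma subdifferential_uminus:
  assumes "J \<in> class_C" and "p \<in> subdifferential J u"
  shows "- p \<in> subdifferential J (- u)"
proof -
  have "ereal (- p \<bullet> v) \<le> J v" for v
  proof -
    have "ereal (p \<bullet> (- v)) \<le> J (- v)"
      using assms(2) unfolding subdifferential_def by blast
    then show ?thesis
      by (simp add: class_C_even[OF assms(1)])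
  qed
  moreover have "ereal (- p \<bullet> - u) = J (- u)"
    using assms(2) by (simp add: class_C_even[OF assms(1)] subdifferential_def)
  ultimately show ?thesis
    by (simp add: subdifferential_def)
qed

lemma eigenvector_uminus:
  assumes "J \<in> class_C" and "is_eigenvector J u lam"
  shows "is_eigenvector J (- u) lam"
  using subdifferential_uminus[OF assms(1), of "lam *\<^sub>R u" u] assms(2)
  by (simp add: is_eigenvector_def)

text \<open>
  The lower bounds \<open>p \<bullet> v\<close> and \<open>p \<bullet> (- v)\<close> for the common value \<open>J v = J (- v)\<close> cannot both be
  negative.
\<close>

lemma class_C_nonneg:
  assumes "J \<in> class_C" and "p \<in> subdifferential J u"
  shows "0 \<le> J v"
proof -
  have "ereal (p \<bullet> v) \<le> J v" "ereal (p \<bullet> (- v)) \<le> J (- v)"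
    using assms(2) unfolding subdifferential_def by blast+
  then have "ereal \<bar>p \<bullet> v\<bar> \<le> J v"
    by (auto simp: class_C_even[OF assms(1)] abs_if)
  then show ?thesis
    by (rule order_trans[rotated]) simp
qed

lemma eigenvector_value:
  assumes "is_eigenvector J u lam"
  shows "J u = ereal (lam * (norm u)\<^sup>2)"
  using assms by (simp add: is_eigenvector_def subdifferential_def power2_norm_eq_inner)

lemma eigenvalue_sign:
  assumes "J \<in> class_C" and "is_eigenvector J u lam" and "u \<noteq> 0"
  shows "0 \<le> lam \<and> (lam = 0 \<longleftrightarrow> J u = 0)"
proof -
  have "0 \<le> J u"
    using class_C_nonneg assms(1,2) unfolding is_eigenvector_def by blast
  with assms(3) show ?thesis
    by (simp add: eigenvector_value[OF assms(2)] zero_le_mult_iff)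
qed

text \<open>
  At the origin \<open>lam *\<^sub>R 0 = 0 *\<^sub>R 0\<close>, so the eigenvalue may be changed to \<open>0\<close> there.
  Away from the origin an eigenvalue \<open>0\<close> would put \<open>u\<close> into the null set of \<open>J\<close>.
\<close>

lemma eigenvalue_zero_iff:
  assumes "is_eigenvector J u lam"
    and definite: "\<And>v. J v = 0 \<Longrightarrow> v = 0"
  shows "is_eigenvector J u 0 \<longleftrightarrow> u = 0"
proof
  assume "is_eigenvector J u 0"
  then show "u = 0"
    using definite by (simp add: eigenvector_value)
next
  assume "u = 0"
  then show "is_eigenvector J u 0"
    using assms(1) by (simp add: is_eigenvector_def)
qed

text \<open>
  Both \<open>p\<close> and \<open>lam u\<close> have inner product \<open>J u\<close> with \<open>u\<close>, so their difference is orthogonal to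
  \<open>u\<close>.
\<close>

lemma norm_subgradient_pythagoras:
  assumes "is_eigenvector J u lam" and "p \<in> subdifferential J u"
  shows "(norm p)\<^sup>2 = (norm (lam *\<^sub>R u))\<^sup>2 + (norm (p - lam *\<^sub>R u))\<^sup>2"
proof -
  have "ereal (p \<bullet> u) = ereal (lam * (u \<bullet> u))"
    using assms by (simp add: is_eigenvector_def subdifferential_def)
  then have "orthogonal (lam *\<^sub>R u) (p - lam *\<^sub>R u)"
    by (simp add: orthogonal_def inner_diff_right inner_commute)
  from norm_add_Pythagorean[OF this] show ?thesis
    by simp
qed

lemma eigenvector_min_norm_subgradient:
  assumes "is_eigenvector J u lam"
  shows "{p. is_arg_min norm (\<lambda>q. q \<in> subdifferential J u) p} = {lam *\<^sub>R u}"
proof -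
  let ?q = "lam *\<^sub>R u"
  have q: "?q \<in> subdifferential J u"
    using assms by (simp add: is_eigenvector_def)
  have le: "norm ?q \<le> norm p" if "p \<in> subdifferential J u" for p
  proof (rule power2_le_imp_le)
    show "(norm ?q)\<^sup>2 \<le> (norm p)\<^sup>2"
      unfolding norm_subgradient_pythagoras[OF assms that] by simp
  qed simp
  have eq: "p = ?q" if "p \<in> subdifferential J u" "norm p \<le> norm ?q" for p
  proof -
    have "(norm p)\<^sup>2 \<le> (norm ?q)\<^sup>2"
      by (rule power_mono[OF that(2) norm_ge_zero])
    then have "(norm (p - ?q))\<^sup>2 \<le> 0"
      using norm_subgradient_pythagoras[OF assms that(1)] by linarith
    then show ?thesis
      by simp
  qed
  have "is_arg_min norm (\<lambda>q. q \<in> subdifferential J u) p \<longleftrightarrow> p = ?q" for p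
    using q le[of p] le eq[of p] unfolding is_arg_min_def not_less[symmetric] by blast
  then show ?thesis
    by simp
qed

theorem proposition2p9:
  fixes J :: "'a::{real_inner, complete_space} \<Rightarrow> ereal"
    and u :: 'a and lam :: real
  assumes "J \<in> class_C"
    and "is_eigenvector J u lam"
  shows "is_eigenvector J (- u) lam
    \<and> (u \<noteq> 0 \<longrightarrow> 0 \<le> lam \<and> (lam = 0 \<longleftrightarrow> J u = 0))
    \<and> ((\<forall>v. J v = 0 \<longrightarrow> v = 0) \<longrightarrow> (is_eigenvector J u 0 \<longleftrightarrow> u = 0))
    \<and> {p. is_arg_min norm (\<lambda>q. q \<in> subdifferential J u) p} = {lam *\<^sub>R u}"
  using eigenvector_uminus[OF assms] eigenvalue_sign[OF assms] eigenvalue_zero_iff[OF assms(2)]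
    eigenvector_min_norm_subgradient[OF assms(2)]
  by blast

end
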